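(* Let $P:\mathbb C^{\mathrm{op}}\to\mathbf{Pos}$ be a primary doctrine and let $\varphi\in P(\mathbf t)$, where $\mathbf t$ is the terminal object of $\mathbb C$. The 1-arrow $(\mathrm{id}_{\mathbb C},\mathfrak f):P\to P_\varphi$ is such that $\top\le\mathfrak f_{\mathbf t}(\varphi)$ in $P_\varphi(\mathbf t)$, and it is universal with respect to this property: for every primary doctrine $R:\mathbb D^{\mathrm{op}}\to\mathbf{Pos}$ and every primary 1-arrow $(G,\mathfrak g):P\to R$ such that $\top\le\mathfrak g_{\mathbf t}(\varphi)$ in $R(\mathbf t_{\mathbb D})$, there exists a primary 1-arrow $(G',\mathfrak g'):P_\varphi\to R$, unique up to a unique natural isomorphism, such that $(G',\mathfrak g')\circ(\mathrm{id}_{\mathbb C},\mathfrak f)=(G,\mathfrak g)$.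
   Context: A doctrine is a functor $P:\mathbb C^{\mathrm{op}}\to\mathbf{Pos}$ with $\mathbb C$ a category with finite products and $\mathbf{Pos}$ the category of posets and monotone maps; the maps $P(f)$ are called reindexings. It is primary if every $P(A)$ has finite meets ($\wedge$, $\top$) and all reindexings preserve them. A 1-arrow (doctrine homomorphism) from $P:\mathbb C^{\mathrm{op}}\to\mathbf{Pos}$ to $R:\mathbb D^{\mathrm{op}}\to\mathbf{Pos}$ is a pair $(F,\mathfrak f)$ with $F:\mathbb C\to\mathbb D$ a finite-product-preserving functor and $\mathfrak f:P\to R\circ F^{\mathrm{op}}$ natural; it is primary if $P,R$ are primary and each $\mathfrak f_A$ preserves finite meets. Composition: $(G,\mathfrak g)\circ(F,\mathfrak f)=(GF,(\mathfrak g_{FA}\mathfrak f_A)_A)$. A 2-cell $(F,\mathfrak f)\Rightarrow(G,\mathfrak g):P\to R$ is a natural transformation $\theta:F\to G$ with $\mathfrak f_A(\alpha)\le R(\theta_A)(\mathfrak g_A(\alpha))$ for all $A$ and $\alpha\in P(A)$. For a primary doctrine $P$ and $\varphi\in P(\mathbf t)$, the doctrine $P_\varphi:\mathbb C^{\mathrm{op}}\to\mathbf{Pos}$ is defined by $P_\varphi(A)=\{\alpha\in P(A)\mid\alpha\le P(!_A)(\varphi)\}$ with the order of $P(A)$, where $!_A:A\to\mathbf t$ is the unique arrow; $P_\varphi(f)$ is the restriction of $P(f)$. It is primary. The 1-arrow $(\mathrm{id}_{\mathbb C},\mathfrak f):P\to P_\varphi$ has $\mathfrak f_A(\alpha)=P(!_A)(\varphi)\wedge\alpha$.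 Conventions: $G(\mathbf t)$ is identified with the terminal object $\mathbf t_{\mathbb D}$. "Unique up to a unique natural isomorphism" means: for any two such primary 1-arrows there is exactly one invertible 2-cell between them whose whiskering with $(\mathrm{id}_{\mathbb C},\mathfrak f)$ is the identity. *)

theory Defs
  imports "HOL-Algebra.Lattice"
begin

text \<open>
  Functors, natural families and 2-cells are stored as total functions that are \<^const>\<open>extensional\<close>
  on their domains (and \<^const>\<open>undefined\<close> elsewhere). Hence HOL equality of 1-arrows and of 2-cells
  is mathematical equality, and \<open>\<exists>!\<close> has its usual meaning.
\<close>

section \<open>Categories with finite products\<close>

record ('o, 'a) category_data =
  Obj :: "'o set"
  Arr :: "'a set"
  Dom :: "'a \<Rightarrow> 'o"
  Cod :: "'a \<Rightarrow> 'o"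
  Id :: "'o \<Rightarrow> 'a"
  Comp :: "'a \<Rightarrow> 'a \<Rightarrow> 'a" (infixl \<open>\<cdot>\<index>\<close> 70)

definition Hom :: "('o, 'a) category_data \<Rightarrow> 'o \<Rightarrow> 'o \<Rightarrow> 'a set" where
  "Hom C A B = {f \<in> Arr C. Dom C f = A \<and> Cod C f = B}"

locale category =
  fixes C :: "('o, 'a) category_data" (structure)
  assumes dom_closed: "f \<in> Arr C \<Longrightarrow> Dom C f \<in> Obj C"
    and cod_closed: "f \<in> Arr C \<Longrightarrow> Cod C f \<in> Obj C"
    and id_closed: "A \<in> Obj C \<Longrightarrow> Id C A \<in> Hom C A A"
    and comp_closed: "\<lbrakk>f \<in> Hom C A B; g \<in> Hom C B D\<rbrakk> \<Longrightarrow> g \<cdot> f \<in> Hom C A D"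
    and id_left: "f \<in> Hom C A B \<Longrightarrow> Id C B \<cdot> f = f"
    and id_right: "f \<in> Hom C A B \<Longrightarrow> f \<cdot> Id C A = f"
    and comp_assoc: "\<lbrakk>f \<in> Hom C A B; g \<in> Hom C B D; h \<in> Hom C D E\<rbrakk> \<Longrightarrow>
      h \<cdot> (g \<cdot> f) = (h \<cdot> g) \<cdot> f"

definition terminal :: "('o, 'a) category_data \<Rightarrow> 'o \<Rightarrow> bool" where
  "terminal C t \<longleftrightarrow> t \<in> Obj C \<and> (\<forall>A \<in> Obj C. \<exists>!f. f \<in> Hom C A t)"

definition bang :: "('o, 'a) category_data \<Rightarrow> 'o \<Rightarrow> 'o \<Rightarrow> 'a" where
  "bang C t A = (THE f. f \<in> Hom C A t)"

text \<open>\<open>X\<close> with projections \<open>\<pi> 0, \<dots>, \<pi> (n - 1)\<close> is a product of \<open>As 0, \<dots>, As (n - 1)\<close>;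
  the case \<open>n = 0\<close> says that \<open>X\<close> is terminal.\<close>

definition is_product ::
  "('o, 'a) category_data \<Rightarrow> nat \<Rightarrow> (nat \<Rightarrow> 'o) \<Rightarrow> 'o \<Rightarrow> (nat \<Rightarrow> 'a) \<Rightarrow> bool" where
  "is_product C n As X \<pi> \<longleftrightarrow>
     X \<in> Obj C \<and> (\<forall>i<n. As i \<in> Obj C \<and> \<pi> i \<in> Hom C X (As i)) \<and>
     (\<forall>Y \<in> Obj C. \<forall>f. (\<forall>i<n. f i \<in> Hom C Y (As i)) \<longrightarrow>
        (\<exists>!h. h \<in> Hom C Y X \<and> (\<forall>i<n. \<pi> i \<cdot>\<^bsub>C\<^esub> h = f i)))"

locale fp_category = category +
  assumes products_exist: "(\<And>i. i < n \<Longrightarrow> As i \<in> Obj C) \<Longrightarrow> \<exists>X \<pi>. is_product C n As X \<pi>"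

record ('o, 'a, 'o2, 'a2) functor_data =
  fobj :: "'o \<Rightarrow> 'o2"
  farr :: "'a \<Rightarrow> 'a2"

locale fp_functor = C: fp_category C + D: fp_category D
  for C :: "('o, 'a) category_data" and D :: "('o2, 'a2) category_data" +
  fixes F :: "('o, 'a, 'o2, 'a2) functor_data"
  assumes fobj_closed: "fobj F \<in> Obj C \<rightarrow>\<^sub>E Obj D"
    and farr_ext: "farr F \<in> extensional (Arr C)"
    and farr_closed: "f \<in> Hom C A B \<Longrightarrow> farr F f \<in> Hom D (fobj F A) (fobj F B)"
    and farr_id: "A \<in> Obj C \<Longrightarrow> farr F (Id C A) = Id D (fobj F A)"
    and farr_comp: "\<lbrakk>f \<in> Hom C A B; g \<in> Hom C B E\<rbrakk> \<Longrightarrow>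
      farr F (g \<cdot>\<^bsub>C\<^esub> f) = farr F g \<cdot>\<^bsub>D\<^esub> farr F f"
    and preserves_products: "is_product C n As X \<pi> \<Longrightarrow>
      is_product D n (\<lambda>i. fobj F (As i)) (fobj F X) (\<lambda>i. farr F (\<pi> i))"

definition id_functor :: "('o, 'a) category_data \<Rightarrow> ('o, 'a, 'o, 'a) functor_data" where
  "id_functor C = \<lparr>fobj = (\<lambda>A \<in> Obj C. A), farr = (\<lambda>f \<in> Arr C. f)\<rparr>"

definition functor_comp ::
  "('o, 'a) category_data \<Rightarrow> ('o2, 'a2, 'o3, 'a3) functor_data \<Rightarrow>
   ('o, 'a, 'o2, 'a2) functor_data \<Rightarrow> ('o, 'a, 'o3, 'a3) functor_data" where
  "functor_comp C G F =
     \<lparr>fobj = compose (Obj C) (fobj G) (fobj F), farr = compose (Arr C) (farr G) (farr F)\<rparr>"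

section \<open>Doctrines\<close>

text \<open>All fibres share the element type \<open>'p\<close>, but each has its own carrier and its own order.\<close>

record ('o, 'a, 'p) doctrine_data =
  base :: "('o, 'a) category_data"
  fib :: "'o \<Rightarrow> 'p gorder"
  reindex :: "'a \<Rightarrow> 'p \<Rightarrow> 'p"

locale doctrine = base: fp_category "base P" for P :: "('o, 'a, 'p) doctrine_data" +
  assumes fib_poset: "A \<in> Obj (base P) \<Longrightarrow> partial_order (fib P A)"
    and reindex_closed: "f \<in> Hom (base P) A B \<Longrightarrow>
      reindex P f \<in> carrier (fib P B) \<rightarrow> carrier (fib P A)"
    and reindex_mono: "f \<in> Hom (base P) A B \<Longrightarrow> isotone (fib P B) (fib P A) (reindex P f)"
    and reindex_id: "\<lbrakk>A \<in> Obj (base P); \<alpha> \<in> carrier (fib P A)\<rbrakk> \<Longrightarrow>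
      reindex P (Id (base P) A) \<alpha> = \<alpha>"
    and reindex_comp:
      "\<lbrakk>f \<in> Hom (base P) A B; g \<in> Hom (base P) B D; \<alpha> \<in> carrier (fib P D)\<rbrakk> \<Longrightarrow>
      reindex P (g \<cdot>\<^bsub>base P\<^esub> f) \<alpha> = reindex P f (reindex P g \<alpha>)"

text \<open>The library's \<^const>\<open>meet_pres\<close> is not usable here: it requires both orders to be lattices.\<close>

definition preserves_finite_meets :: "'p gorder \<Rightarrow> 'q gorder \<Rightarrow> ('p \<Rightarrow> 'q) \<Rightarrow> bool" where
  "preserves_finite_meets L M f \<longleftrightarrow>
     f \<top>\<^bsub>L\<^esub> = \<top>\<^bsub>M\<^esub> \<and>
     (\<forall>x \<in> carrier L. \<forall>y \<in> carrier L. f (x \<sqinter>\<^bsub>L\<^esub> y) = f x \<sqinter>\<^bsub>M\<^esub> f y)"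

locale primary_doctrine = doctrine +
  assumes fib_meets: "A \<in> Obj (base P) \<Longrightarrow> lower_semilattice (fib P A)"
    and fib_top: "A \<in> Obj (base P) \<Longrightarrow> weak_partial_order_top (fib P A)"
    and reindex_meets: "f \<in> Hom (base P) A B \<Longrightarrow>
      preserves_finite_meets (fib P B) (fib P A) (reindex P f)"

section \<open>1-arrows and 2-cells\<close>

type_synonym ('o, 'a, 'p, 'o2, 'a2, 'p2) one_arrow =
  "('o, 'a, 'o2, 'a2) functor_data \<times> ('o \<Rightarrow> 'p \<Rightarrow> 'p2)"

fun one_arrow :: "('o, 'a, 'p) doctrine_data \<Rightarrow> ('o2, 'a2, 'p2) doctrine_data \<Rightarrow>
    ('o, 'a, 'p, 'o2, 'a2, 'p2) one_arrow \<Rightarrow> bool" where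
  "one_arrow P R (F, \<ff>) \<longleftrightarrow>
     doctrine P \<and> doctrine R \<and> fp_functor (base P) (base R) F \<and>
     \<ff> \<in> extensional (Obj (base P)) \<and>
     (\<forall>A \<in> Obj (base P).
        \<ff> A \<in> carrier (fib P A) \<rightarrow>\<^sub>E carrier (fib R (fobj F A)) \<and>
        isotone (fib P A) (fib R (fobj F A)) (\<ff> A)) \<and>
     (\<forall>A \<in> Obj (base P). \<forall>B \<in> Obj (base P). \<forall>f \<in> Hom (base P) A B. \<forall>\<beta> \<in> carrier (fib P B).
        \<ff> A (reindex P f \<beta>) = reindex R (farr F f) (\<ff> B \<beta>))"

fun primary_one_arrow :: "('o, 'a, 'p) doctrine_data \<Rightarrow> ('o2, 'a2, 'p2) doctrine_data \<Rightarrow>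
    ('o, 'a, 'p, 'o2, 'a2, 'p2) one_arrow \<Rightarrow> bool" where
  "primary_one_arrow P R (F, \<ff>) \<longleftrightarrow>
     one_arrow P R (F, \<ff>) \<and> primary_doctrine P \<and> primary_doctrine R \<and>
     (\<forall>A \<in> Obj (base P). preserves_finite_meets (fib P A) (fib R (fobj F A)) (\<ff> A))"

text \<open>In \<open>one_arrow_comp P (G, \<gg>) (F, \<ff>)\<close> the parameter \<open>P\<close> is the source of \<open>(F, \<ff>)\<close>.\<close>

fun one_arrow_comp :: "('o, 'a, 'p) doctrine_data \<Rightarrow>
    ('o2, 'a2, 'p2, 'o3, 'a3, 'p3) one_arrow \<Rightarrow> ('o, 'a, 'p, 'o2, 'a2, 'p2) one_arrow \<Rightarrow>
    ('o, 'a, 'p, 'o3, 'a3, 'p3) one_arrow" where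
  "one_arrow_comp P (G, \<gg>) (F, \<ff>) =
     (functor_comp (base P) G F,
      (\<lambda>A \<in> Obj (base P). compose (carrier (fib P A)) (\<gg> (fobj F A)) (\<ff> A)))"

fun two_cell :: "('o, 'a, 'p) doctrine_data \<Rightarrow> ('o2, 'a2, 'p2) doctrine_data \<Rightarrow>
    ('o, 'a, 'p, 'o2, 'a2, 'p2) one_arrow \<Rightarrow> ('o, 'a, 'p, 'o2, 'a2, 'p2) one_arrow \<Rightarrow>
    ('o \<Rightarrow> 'a2) \<Rightarrow> bool" where
  "two_cell P R (F, \<ff>) (G, \<gg>) \<theta> \<longleftrightarrow>
     \<theta> \<in> extensional (Obj (base P)) \<and>
     (\<forall>A \<in> Obj (base P). \<theta> A \<in> Hom (base R) (fobj F A) (fobj G A)) \<and>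
     (\<forall>A \<in> Obj (base P). \<forall>B \<in> Obj (base P). \<forall>f \<in> Hom (base P) A B.
        farr G f \<cdot>\<^bsub>base R\<^esub> \<theta> A = \<theta> B \<cdot>\<^bsub>base R\<^esub> farr F f) \<and>
     (\<forall>A \<in> Obj (base P). \<forall>\<alpha> \<in> carrier (fib P A).
        \<ff> A \<alpha> \<sqsubseteq>\<^bsub>fib R (fobj F A)\<^esub> reindex R (\<theta> A) (\<gg> A \<alpha>))"

fun id_two_cell :: "('o, 'a, 'p) doctrine_data \<Rightarrow> ('o2, 'a2, 'p2) doctrine_data \<Rightarrow>
    ('o, 'a, 'p, 'o2, 'a2, 'p2) one_arrow \<Rightarrow> 'o \<Rightarrow> 'a2" where
  "id_two_cell P R (F, \<ff>) = (\<lambda>A \<in> Obj (base P). Id (base R) (fobj F A))"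

definition two_cell_comp :: "('o, 'a, 'p) doctrine_data \<Rightarrow> ('o2, 'a2, 'p2) doctrine_data \<Rightarrow>
    ('o \<Rightarrow> 'a2) \<Rightarrow> ('o \<Rightarrow> 'a2) \<Rightarrow> 'o \<Rightarrow> 'a2" where
  "two_cell_comp P R \<eta> \<theta> = (\<lambda>A \<in> Obj (base P). \<eta> A \<cdot>\<^bsub>base R\<^esub> \<theta> A)"

definition invertible_two_cell :: "('o, 'a, 'p) doctrine_data \<Rightarrow>
    ('o2, 'a2, 'p2) doctrine_data \<Rightarrow> ('o, 'a, 'p, 'o2, 'a2, 'p2) one_arrow \<Rightarrow>
    ('o, 'a, 'p, 'o2, 'a2, 'p2) one_arrow \<Rightarrow> ('o \<Rightarrow> 'a2) \<Rightarrow> bool" where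
  "invertible_two_cell P R X Y \<theta> \<longleftrightarrow>
     two_cell P R X Y \<theta> \<and>
     (\<exists>\<eta>. two_cell P R Y X \<eta> \<and>
        two_cell_comp P R \<eta> \<theta> = id_two_cell P R X \<and>
        two_cell_comp P R \<theta> \<eta> = id_two_cell P R Y)"

text \<open>\<open>whisker P \<theta> (F, \<ff>)\<close> precomposes the 2-cell \<open>\<theta>\<close> with the 1-arrow \<open>(F, \<ff>)\<close> of source \<open>P\<close>.\<close>

fun whisker :: "('o, 'a, 'p) doctrine_data \<Rightarrow> ('o2 \<Rightarrow> 'a3) \<Rightarrow>
    ('o, 'a, 'p, 'o2, 'a2, 'p2) one_arrow \<Rightarrow> 'o \<Rightarrow> 'a3" where
  "whisker P \<theta> (F, \<ff>) = compose (Obj (base P)) \<theta> (fobj F)"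

section \<open>The doctrine \<open>P\<^sub>\<phi>\<close> and the 1-arrow \<open>P \<rightarrow> P\<^sub>\<phi>\<close>\<close>

text \<open>The order and the reindexing maps are left unchanged; only their values on the smaller
  carriers matter.\<close>

definition below_doctrine ::
  "('o, 'a, 'p) doctrine_data \<Rightarrow> 'o \<Rightarrow> 'p \<Rightarrow> ('o, 'a, 'p) doctrine_data" where
  "below_doctrine P t \<phi> = P\<lparr>fib := \<lambda>A. (fib P A)\<lparr>carrier :=
     {\<alpha> \<in> carrier (fib P A). \<alpha> \<sqsubseteq>\<^bsub>fib P A\<^esub> reindex P (bang (base P) t A) \<phi>}\<rparr>\<rparr>"

definition below_map :: "('o, 'a, 'p) doctrine_data \<Rightarrow> 'o \<Rightarrow> 'p \<Rightarrow> 'o \<Rightarrow> 'p \<Rightarrow> 'p" where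
  "below_map P t \<phi> = (\<lambda>A \<in> Obj (base P). \<lambda>\<alpha> \<in> carrier (fib P A).
     reindex P (bang (base P) t A) \<phi> \<sqinter>\<^bsub>fib P A\<^esub> \<alpha>)"

definition below_arrow ::
  "('o, 'a, 'p) doctrine_data \<Rightarrow> 'o \<Rightarrow> 'p \<Rightarrow> ('o, 'a, 'p, 'o, 'a, 'p) one_arrow" where
  "below_arrow P t \<phi> = (id_functor (base P), below_map P t \<phi>)"

end

theory Submission
  imports Defs
begin

text \<open>
  Reindexing along \<open>!\<^sub>A\<close> turns \<open>\<phi>\<close> into an element \<open>\<phi>\<^sub>A\<close> of each fibre, stable under reindexing,
  and \<open>P\<^sub>\<phi>(A)\<close> is the principal down-set of \<open>\<phi>\<^sub>A\<close>, with the meets of \<open>P(A)\<close> and top \<open>\<phi>\<^sub>A\<close>. The map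
  \<open>\<phi>\<^sub>A \<and> _\<close> is a retraction of \<open>P(A)\<close> onto it. Hence a factorisation of \<open>(G, \<gg>)\<close> through \<open>P\<^sub>\<phi>\<close> must
  be \<open>G\<close> with the restrictions of \<open>\<gg>\<close>, and this works because \<open>\<gg>\<^sub>A(\<phi>\<^sub>A)\<close> is a reindexing of
  \<open>\<gg>\<^sub>t(\<phi>) = \<top>\<close>, so that \<open>\<gg>\<^sub>A(\<phi>\<^sub>A \<and> \<alpha>) = \<gg>\<^sub>A(\<alpha>)\<close>. The factorisation is thus unique on the nose, and
  whiskering with \<open>(id, \<ff>)\<close> forgets nothing of a 2-cell.
\<close>

section \<open>Principal down-sets of meet-semilattices\<close>

locale bounded_meet_semilattice = lower_semilattice L + weak_partial_order_top L
  for L (structure)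
begin

text \<open>\<open>\<sqinter>\<close> is given by a choice operator, so a meet is computed by
  exhibiting a greatest lower bound and applying antisymmetry.\<close>

lemma meet_equality:
  assumes "x \<in> carrier L" "y \<in> carrier L" "m \<in> carrier L" "m \<sqsubseteq> x" "m \<sqsubseteq> y"
    and "\<And>z. \<lbrakk>z \<in> carrier L; z \<sqsubseteq> x; z \<sqsubseteq> y\<rbrakk> \<Longrightarrow> z \<sqsubseteq> m"
  shows "x \<sqinter> y = m"
  using assms by (intro le_antisym) (simp_all add: meet_le meet_left meet_right)

lemma top_equality:
  assumes "u \<in> carrier L" "\<And>x. x \<in> carrier L \<Longrightarrow> x \<sqsubseteq> u"
  shows "\<top> = u"
  using assms by (intro le_antisym) auto

lemma meet_absorb:
  assumes "x \<in> carrier L" "u \<in> carrier L" "x \<sqsubseteq> u"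
  shows "u \<sqinter> x = x"
  using assms by (intro meet_equality) simp_all

lemma top_meet:
  assumes "x \<in> carrier L"
  shows "\<top> \<sqinter> x = x"
  using assms by (intro meet_absorb) simp_all

lemma meet_mono:
  assumes "u \<in> carrier L" "x \<in> carrier L" "y \<in> carrier L" "x \<sqsubseteq> y"
  shows "u \<sqinter> x \<sqsubseteq> u \<sqinter> y"
proof -
  have "u \<sqinter> x \<sqsubseteq> y"
    using le_trans[OF meet_right] assms by simp
  then show ?thesis
    using assms by (simp add: meet_le meet_left)
qed

text \<open>Both sides are the greatest lower bound of \<open>u\<close>, \<open>x\<close> and
  \<open>y\<close>. This makes meeting with \<open>u\<close> preserve binary meets.\<close>

lemma meet_distrib:
  assumes "u \<in> carrier L" "x \<in> carrier L" "y \<in> carrier L"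
  shows "u \<sqinter> (x \<sqinter> y) = (u \<sqinter> x) \<sqinter> (u \<sqinter> y)"
proof (rule meet_equality)
  show closed: "u \<in> carrier L" "x \<sqinter> y \<in> carrier L"
    "(u \<sqinter> x) \<sqinter> (u \<sqinter> y) \<in> carrier L"
    using assms by auto
  have le: "(u \<sqinter> x) \<sqinter> (u \<sqinter> y) \<sqsubseteq> u \<sqinter> x" "(u \<sqinter> x) \<sqinter> (u \<sqinter> y) \<sqsubseteq> u \<sqinter> y"
    using assms by (simp_all add: meet_left meet_right)
  show "(u \<sqinter> x) \<sqinter> (u \<sqinter> y) \<sqsubseteq> u"
    using le_trans[OF le(1) meet_left] assms by simp
  have "(u \<sqinter> x) \<sqinter> (u \<sqinter> y) \<sqsubseteq> x" "(u \<sqinter> x) \<sqinter> (u \<sqinter> y) \<sqsubseteq> y"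
    using le_trans[OF le(1) meet_right] le_trans[OF le(2) meet_right] assms by simp_all
  then show "(u \<sqinter> x) \<sqinter> (u \<sqinter> y) \<sqsubseteq> x \<sqinter> y"
    using assms by (simp add: meet_le)
  fix z assume z: "z \<in> carrier L" "z \<sqsubseteq> u" "z \<sqsubseteq> x \<sqinter> y"
  have "z \<sqsubseteq> x" "z \<sqsubseteq> y"
    using le_trans[OF z(3) meet_left] le_trans[OF z(3) meet_right] assms z(1) by simp_all
  then show "z \<sqsubseteq> (u \<sqinter> x) \<sqinter> (u \<sqinter> y)"
    using assms z by (simp add: meet_le)
qed

end

text \<open>Shrinks the carrier exactly as \<open>below_doctrine\<close> does, keeping order and
  equality, so that \<open>fib_Q\<close> holds by unfolding.\<close>

definition down :: "'p gorder \<Rightarrow> 'p \<Rightarrow> 'p gorder" where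
  "down L u = L\<lparr>carrier := {x \<in> carrier L. x \<sqsubseteq>\<^bsub>L\<^esub> u}\<rparr>"

lemma carrier_down: "carrier (down L u) = {x \<in> carrier L. x \<sqsubseteq>\<^bsub>L\<^esub> u}"
  and le_down: "x \<sqsubseteq>\<^bsub>down L u\<^esub> y \<longleftrightarrow> x \<sqsubseteq>\<^bsub>L\<^esub> y"
  by (simp_all add: down_def)

context
  fixes L :: "'p gorder" (structure) and u :: 'p
  assumes L: "bounded_meet_semilattice L" and u: "u \<in> carrier L"
begin

interpretation bounded_meet_semilattice L by (rule L)

text \<open>A meet of elements below \<open>u\<close> is again below \<open>u\<close> and stays a
  greatest lower bound in the smaller carrier; \<open>u\<close> is the greatest element.\<close>

lemma bounded_meet_semilattice_down: "bounded_meet_semilattice (down L u)"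
proof -
  interpret W: weak_partial_order "down L u"
    unfolding down_def by (rule weak_partial_order_subset) (auto intro: weak_partial_order_axioms)
  show ?thesis
  proof unfold_locales
    show "(.=\<^bsub>down L u\<^esub>) = (=)"
      by (simp add: down_def eq_is_equal)
    show "\<exists>s. greatest (down L u) s (Lower (down L u) {x, y})"
      if "x \<in> carrier (down L u)" "y \<in> carrier (down L u)" for x y
    proof
      have "x \<in> carrier L" "y \<in> carrier L" "x \<sqsubseteq> u" "y \<sqsubseteq> u"
        using that by (auto simp: carrier_down)
      then have "x \<sqinter> y \<sqsubseteq> u"
        using u le_trans[OF meet_left] by simp
      then show "greatest (down L u) (x \<sqinter> y) (Lower (down L u) {x, y})"
        using \<open>x \<in> carrier L\<close> \<open>y \<in> carrier L\<close> \<open>x \<sqsubseteq> u\<close> \<open>y \<sqsubseteq> u\<close>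
        by (auto simp: greatest_def Lower_def carrier_down le_down meet_left meet_right
            intro: meet_le)
    qed
    show "\<exists>x. greatest (down L u) x (carrier (down L u))"
      using u by (intro exI[of _ u]) (auto simp: greatest_def carrier_down le_down)
  qed
qed

interpretation down: bounded_meet_semilattice "down L u"
  by (rule bounded_meet_semilattice_down)

lemma top_down: "\<top>\<^bsub>down L u\<^esub> = u"
  using u by (intro down.top_equality) (auto simp: carrier_down le_down)

lemma meet_down:
  assumes "x \<in> carrier (down L u)" "y \<in> carrier (down L u)"
  shows "x \<sqinter>\<^bsub>down L u\<^esub> y = x \<sqinter> y"
proof (rule down.meet_equality)
  have "x \<in> carrier L" "y \<in> carrier L" "x \<sqsubseteq> u"
    using assms by (auto simp: carrier_down)
  moreover from this have "x \<sqinter> y \<sqsubseteq> u"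
    using u le_trans[OF meet_left] by simp
  ultimately show "x \<sqinter> y \<in> carrier (down L u)" "x \<sqinter> y \<sqsubseteq>\<^bsub>down L u\<^esub> x"
    "x \<sqinter> y \<sqsubseteq>\<^bsub>down L u\<^esub> y"
    "\<And>z. \<lbrakk>z \<in> carrier (down L u); z \<sqsubseteq>\<^bsub>down L u\<^esub> x; z \<sqsubseteq>\<^bsub>down L u\<^esub> y\<rbrakk> \<Longrightarrow>
      z \<sqsubseteq>\<^bsub>down L u\<^esub> x \<sqinter> y"
    by (auto simp: carrier_down le_down meet_left meet_right intro: meet_le)
qed (use assms in auto)

lemma meet_in_down:
  assumes "x \<in> carrier L"
  shows "u \<sqinter> x \<in> carrier (down L u)"
  using assms u by (auto simp: carrier_down meet_left)

lemma isotone_meet_down: "isotone L (down L u) (\<lambda>x. u \<sqinter> x)"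
  using u by (auto simp: isotone_def le_down meet_mono weak_partial_order_axioms
      down.weak_partial_order_axioms)

text \<open>The map sends \<open>\<top>\<close> to \<open>u\<close>, the top of the down-set; binary
  meets are handled by \<open>meet_distrib\<close>.\<close>

lemma preserves_finite_meets_meet_down: "preserves_finite_meets L (down L u) (\<lambda>x. u \<sqinter> x)"
  unfolding preserves_finite_meets_def
proof (intro conjI ballI)
  show "u \<sqinter> \<top> = \<top>\<^bsub>down L u\<^esub>"
    using u by (simp add: top_down meet_comm[of L u] top_meet)
  show "u \<sqinter> (x \<sqinter> y) = (u \<sqinter> x) \<sqinter>\<^bsub>down L u\<^esub> (u \<sqinter> y)"
    if "x \<in> carrier L" "y \<in> carrier L" for x y
    using that u by (simp only: meet_down meet_in_down meet_distrib)
qed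

end

section \<open>The doctrine below a truth value\<close>

text \<open>Needed for \<open>id_functor\<close>, which is the identity only on the objects and
  arrows of the category; \<open>is_product\<close> looks only at indices below
  \<open>n\<close>.\<close>

lemma is_product_cong:
  assumes "\<And>i. i < n \<Longrightarrow> As i = As' i" "\<And>i. i < n \<Longrightarrow> \<pi> i = \<pi>' i"
  shows "is_product C n As X \<pi> \<longleftrightarrow> is_product C n As' X \<pi>'"
  using assms by (simp add: is_product_def cong: conj_cong)

lemma (in category) HomD:
  assumes "f \<in> Hom C A B"
  shows "f \<in> Arr C" "A \<in> Obj C" "B \<in> Obj C"
  using assms dom_closed cod_closed by (auto simp: Hom_def)

lemma (in fp_category) fp_functor_id: "fp_functor C C (id_functor C)"
proof unfold_locales
  show "fobj (id_functor C) \<in> Obj C \<rightarrow>\<^sub>E Obj C" "farr (id_functor C) \<in> extensional (Arr C)"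
    by (auto simp: id_functor_def)
  fix f g A B E assume f: "f \<in> Hom C A B"
  then show "farr (id_functor C) f \<in> Hom C (fobj (id_functor C) A) (fobj (id_functor C) B)"
    using HomD[OF f] by (simp add: id_functor_def)
  assume g: "g \<in> Hom C B E"
  then show "farr (id_functor C) (g \<cdot> f) = farr (id_functor C) g \<cdot> farr (id_functor C) f"
    using HomD[OF f] HomD[OF g] HomD[OF comp_closed[OF f g]] by (simp add: id_functor_def)
next
  fix A assume "A \<in> Obj C"
  then show "farr (id_functor C) (Id C A) = Id C (fobj (id_functor C) A)"
    using HomD[OF id_closed] by (simp add: id_functor_def)
next
  fix n As X \<pi> assume prod: "is_product C n As X \<pi>"
  then have "\<And>i. i < n \<Longrightarrow> As i \<in> Obj C" "\<And>i. i < n \<Longrightarrow> \<pi> i \<in> Arr C" "X \<in> Obj C"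
    by (auto simp: is_product_def Hom_def)
  then show "is_product C n (\<lambda>i. fobj (id_functor C) (As i)) (fobj (id_functor C) X)
      (\<lambda>i. farr (id_functor C) (\<pi> i))"
    using prod is_product_cong[of n "\<lambda>i. fobj (id_functor C) (As i)" As "\<lambda>i. farr (id_functor C) (\<pi> i)" \<pi>]
    by (simp add: id_functor_def)
qed

locale pointed_primary_doctrine = primary_doctrine P
  for P :: "('o, 'a, 'p) doctrine_data" +
  fixes t :: 'o and \<phi> :: 'p
  assumes terminal_t: "terminal (base P) t"
    and truth_value: "\<phi> \<in> carrier (fib P t)"
begin

abbreviation truth :: "'o \<Rightarrow> 'p" where
  "truth A \<equiv> reindex P (bang (base P) t A) \<phi>"

abbreviation Q :: "('o, 'a, 'p) doctrine_data" where
  "Q \<equiv> below_doctrine P t \<phi>"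

lemma fib_semilattice: "A \<in> Obj (base P) \<Longrightarrow> bounded_meet_semilattice (fib P A)"
  by (simp add: bounded_meet_semilattice_def fib_meets fib_top)

lemma t_closed: "t \<in> Obj (base P)"
  using terminal_t by (simp add: terminal_def)

lemma bang_closed: "A \<in> Obj (base P) \<Longrightarrow> bang (base P) t A \<in> Hom (base P) A t"
  using terminal_t theI'[of "\<lambda>f. f \<in> Hom (base P) A t"] by (simp add: bang_def terminal_def)

lemma bang_unique: "f \<in> Hom (base P) A t \<Longrightarrow> bang (base P) t A = f"
  using terminal_t bang_closed base.HomD(2)[of f A t] unfolding terminal_def by blast

lemma truth_closed: "A \<in> Obj (base P) \<Longrightarrow> truth A \<in> carrier (fib P A)"
  using reindex_closed[OF bang_closed] truth_value by blast

lemma truth_t: "truth t = \<phi>"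
  using bang_unique[OF base.id_closed] reindex_id t_closed truth_value by simp

text \<open>By terminality, \<open>!_B\<close> after \<open>f\<close> is \<open>!_A\<close>. This
  stability gives closure of \<open>Q\<close> under reindexing, preservation of its tops, and
  naturality of \<open>below_map\<close>.\<close>

lemma reindex_truth:
  assumes f: "f \<in> Hom (base P) A B"
  shows "reindex P f (truth B) = truth A"
proof -
  have B: "bang (base P) t B \<in> Hom (base P) B t"
    using base.HomD(3)[OF f] by (rule bang_closed)
  show ?thesis
    using reindex_comp[OF f B truth_value] bang_unique[OF base.comp_closed[OF f B]] by simp
qed

lemma base_Q [simp]: "base Q = base P"
  and fib_Q: "fib Q A = down (fib P A) (truth A)"
  and reindex_Q [simp]: "reindex Q = reindex P"
  by (simp_all add: below_doctrine_def down_def)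

lemma fib_Q_semilattice: "A \<in> Obj (base P) \<Longrightarrow> bounded_meet_semilattice (fib Q A)"
  unfolding fib_Q by (intro bounded_meet_semilattice_down fib_semilattice truth_closed)

lemma carrier_Q_subset: "\<alpha> \<in> carrier (fib Q A) \<Longrightarrow> \<alpha> \<in> carrier (fib P A)"
  by (simp add: fib_Q carrier_down)

lemma top_Q: "A \<in> Obj (base P) \<Longrightarrow> \<top>\<^bsub>fib Q A\<^esub> = truth A"
  unfolding fib_Q by (intro top_down fib_semilattice truth_closed)

lemma meet_Q:
  "\<lbrakk>A \<in> Obj (base P); \<alpha> \<in> carrier (fib Q A); \<beta> \<in> carrier (fib Q A)\<rbrakk> \<Longrightarrow>
    \<alpha> \<sqinter>\<^bsub>fib Q A\<^esub> \<beta> = \<alpha> \<sqinter>\<^bsub>fib P A\<^esub> \<beta>"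
  unfolding fib_Q by (intro meet_down fib_semilattice truth_closed)

text \<open>Elements of \<open>Q\<close> lie below \<open>truth A\<close>, so
  \<open>below_map\<close> fixes them and hence reaches all of \<open>Q\<close>. Uniqueness of
  factorisations rests on this.\<close>

lemma truth_meet:
  assumes "A \<in> Obj (base P)" "\<alpha> \<in> carrier (fib Q A)"
  shows "truth A \<sqinter>\<^bsub>fib P A\<^esub> \<alpha> = \<alpha>"
  using assms bounded_meet_semilattice.meet_absorb[OF fib_semilattice] truth_closed
  by (simp add: fib_Q carrier_down)

text \<open>Monotonicity carries the bound \<open>truth B\<close> to its reindexing, which is
  \<open>truth A\<close>.\<close>

lemma reindex_Q_closed:
  assumes f: "f \<in> Hom (base P) A B" and \<beta>: "\<beta> \<in> carrier (fib Q B)"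
  shows "reindex P f \<beta> \<in> carrier (fib Q A)"
proof -
  have "\<beta> \<in> carrier (fib P B)" "\<beta> \<sqsubseteq>\<^bsub>fib P B\<^esub> truth B"
    using \<beta> by (auto simp: fib_Q carrier_down)
  then have "reindex P f \<beta> \<sqsubseteq>\<^bsub>fib P A\<^esub> reindex P f (truth B)"
    using use_iso2[OF reindex_mono[OF f]] truth_closed base.HomD(3)[OF f] by blast
  then show ?thesis
    using reindex_closed[OF f] \<open>\<beta> \<in> carrier (fib P B)\<close> reindex_truth[OF f]
    by (auto simp: fib_Q carrier_down)
qed

text \<open>The order is inherited, but \<open>isotone\<close> also asserts that its source is a
  weak partial order, which has to be supplied for \<open>fib Q A\<close>.\<close>

lemma isotone_restrict_Q:
  assumes "A \<in> Obj (base P)" "isotone (fib P A) M h"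
  shows "isotone (fib Q A) M h"
  using assms fib_Q_semilattice[of A]
  by (auto simp: isotone_def fib_Q carrier_down le_down bounded_meet_semilattice_def
      weak_partial_order_top_def)

lemma primary_doctrine_Q: "primary_doctrine Q"
proof -
  have fib: "lower_semilattice (fib Q A)" "weak_partial_order_top (fib Q A)"
    if "A \<in> Obj (base P)" for A
    using fib_Q_semilattice[OF that] by (auto simp: bounded_meet_semilattice_def)
  have iso: "isotone (fib Q B) (fib Q A) (reindex P f)" if f: "f \<in> Hom (base P) A B" for f A B
    using isotone_restrict_Q[OF base.HomD(3)[OF f] reindex_mono[OF f]]
      fib(2)[OF base.HomD(2)[OF f]]
    by (auto simp: isotone_def fib_Q le_down weak_partial_order_top_def)
  \<comment> \<open>The top to be preserved is now \<open>truth B\<close>, hence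
    \<open>reindex_truth\<close>; binary meets are those of \<open>P\<close>.\<close>
  have pres: "preserves_finite_meets (fib Q B) (fib Q A) (reindex P f)"
    if f: "f \<in> Hom (base P) A B" for f A B
    using reindex_meets[OF f] base.HomD[OF f] reindex_Q_closed[OF f]
    by (simp add: preserves_finite_meets_def top_Q meet_Q reindex_truth[OF f] carrier_Q_subset)
  show ?thesis
  proof (intro primary_doctrine.intro doctrine.intro doctrine_axioms.intro
      primary_doctrine_axioms.intro; simp only: base_Q reindex_Q)
    show "fp_category (base P)" ..
    show "partial_order (fib Q A)" if "A \<in> Obj (base P)" for A
      using fib(1)[OF that] by (simp add: lower_semilattice_def)
  qed (auto intro: fib iso pres reindex_Q_closed reindex_id reindex_comp carrier_Q_subset)
qed

section \<open>The 1-arrow from \<open>P\<close> to \<open>Q\<close>\<close>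

lemma primary_below_arrow: "primary_one_arrow P Q (below_arrow P t \<phi>)"
proof -
  have id: "fobj (id_functor (base P)) A = A" if "A \<in> Obj (base P)" for A
    using that by (simp add: id_functor_def)
  have arr: "farr (id_functor (base P)) f = f" if "f \<in> Arr (base P)" for f
    using that by (simp add: id_functor_def)
  have ext: "below_map P t \<phi> \<in> extensional (Obj (base P))"
    by (simp add: below_map_def)
  have meet_closed: "\<alpha> \<sqinter>\<^bsub>fib P A\<^esub> \<beta> \<in> carrier (fib P A)"
    if "A \<in> Obj (base P)" "\<alpha> \<in> carrier (fib P A)" "\<beta> \<in> carrier (fib P A)" for A \<alpha> \<beta>
  proof -
    interpret bounded_meet_semilattice "fib P A" using fib_semilattice that(1) .
    show ?thesis using that by simp
  qed
  have top_closed: "\<top>\<^bsub>fib P A\<^esub> \<in> carrier (fib P A)" if "A \<in> Obj (base P)" for A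
    using weak_partial_order_top.top_closed[OF fib_top[OF that]] .
  have "below_map P t \<phi> A \<in> carrier (fib P A) \<rightarrow>\<^sub>E carrier (fib Q A)"
    "isotone (fib P A) (fib Q A) (below_map P t \<phi> A)"
    "preserves_finite_meets (fib P A) (fib Q A) (below_map P t \<phi> A)"
    if A: "A \<in> Obj (base P)" for A
    using A meet_in_down[OF fib_semilattice truth_closed, OF A A]
      isotone_meet_down[OF fib_semilattice truth_closed, OF A A]
      preserves_finite_meets_meet_down[OF fib_semilattice truth_closed, OF A A]
    by (auto simp: below_map_def fib_Q isotone_def preserves_finite_meets_def meet_closed
        top_closed)
  \<comment> \<open>Naturality: reindexing along \<open>f\<close> preserves the meet and sends
    \<open>truth B\<close> to \<open>truth A\<close>.\<close>
  moreover have "below_map P t \<phi> A (reindex P f \<beta>) = reindex P f (below_map P t \<phi> B \<beta>)"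
    if f: "f \<in> Hom (base P) A B" and \<beta>: "\<beta> \<in> carrier (fib P B)" for A B f \<beta>
    using base.HomD[OF f] funcset_mem[OF reindex_closed[OF f] \<beta>] \<beta> reindex_meets[OF f]
      truth_closed reindex_truth[OF f]
    by (simp add: below_map_def preserves_finite_meets_def)
  ultimately show ?thesis
    using primary_doctrine_axioms primary_doctrine_Q base.fp_functor_id base.HomD(1)
    by (auto simp: below_arrow_def id primary_doctrine_def ext arr)
qed

lemma top_le_below_map: "\<top>\<^bsub>fib Q t\<^esub> \<sqsubseteq>\<^bsub>fib Q t\<^esub> below_map P t \<phi> t \<phi>"
proof -
  interpret Q: bounded_meet_semilattice "fib Q t"
    using fib_Q_semilattice t_closed .
  \<comment> \<open>The inequality becomes \<open>\<phi> \<le> \<phi> \<sqinter> \<phi>\<close>.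
    That \<open>\<phi>\<close> lies in the fibre of \<open>Q\<close> is \<open>Q.top_closed\<close>
    read through \<open>top_Q\<close>; as a simp rule it would reduce that very fact to
    \<open>True\<close>.\<close>
  show ?thesis
    using top_Q[OF t_closed] truth_meet[OF t_closed, of \<phi>] Q.top_closed t_closed truth_value
    by (simp add: below_map_def truth_t del: Q.top_closed)
qed

section \<open>The universal property\<close>

text \<open>The only possible factorisation of \<open>X\<close>. The components are made extensional
  on the smaller carriers, so that uniqueness can be literal equality.\<close>

definition below_factor ::
  "('o, 'a, 'p, 'o2, 'a2, 'p2) one_arrow \<Rightarrow> ('o, 'a, 'p, 'o2, 'a2, 'p2) one_arrow" where
  "below_factor X = (fst X, \<lambda>A \<in> Obj (base P). restrict (snd X A) (carrier (fib Q A)))"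

lemma functor_comp_id:
  assumes "fp_functor (base P) D F"
  shows "functor_comp (base P) F (id_functor (base P)) = F"
proof -
  interpret fp_functor "base P" D F by fact
  have "fobj F \<in> extensional (Obj (base P))"
    using fobj_closed by (simp add: PiE_def)
  then show ?thesis
    using farr_ext
    by (auto simp: functor_comp_def id_functor_def compose_def restrict_def extensional_def fun_eq_iff
        intro!: functor_data.equality)
qed

lemma one_arrow_comp_below_arrow:
  assumes "fp_functor (base P) D F"
  shows "one_arrow_comp P (F, \<hh>) (below_arrow P t \<phi>) =
    (F, \<lambda>A \<in> Obj (base P). \<lambda>\<alpha> \<in> carrier (fib P A). \<hh> A (truth A \<sqinter>\<^bsub>fib P A\<^esub> \<alpha>))"
  using functor_comp_id[OF assms]
  by (auto simp: below_arrow_def below_map_def compose_def id_functor_def fun_eq_iff restrict_def)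

text \<open>The composite has values \<open>\<hh> A (truth A \<sqinter> \<alpha>)\<close>, which for
  \<open>\<alpha>\<close> in \<open>Q\<close> is \<open>\<hh> A \<alpha>\<close> itself; so
  \<open>X\<close> determines \<open>\<hh>\<close>.\<close>

lemma below_factor_unique:
  assumes H: "one_arrow Q R H"
    and comp: "one_arrow_comp P H (below_arrow P t \<phi>) = X"
  shows "H = below_factor X"
proof -
  obtain F \<hh> where H_eq: "H = (F, \<hh>)" by fastforce
  have F: "fp_functor (base P) (base R) F" and ext: "\<hh> \<in> extensional (Obj (base P))"
    and hh: "\<And>A. A \<in> Obj (base P) \<Longrightarrow> \<hh> A \<in> extensional (carrier (fib Q A))"
    using H by (auto simp: H_eq PiE_def)
  \<comment> \<open>Outside the domains both sides agree by extensionality, so \<open>A\<close> and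
    \<open>\<alpha>\<close> can be arbitrary.\<close>
  have "\<hh> A \<alpha> = snd (below_factor X) A \<alpha>" for A \<alpha>
    using ext hh[of A] truth_meet[of A \<alpha>] carrier_Q_subset[of \<alpha> A]
    unfolding comp[symmetric] H_eq one_arrow_comp_below_arrow[OF F]
    by (auto simp: below_factor_def extensional_def restrict_def)
  moreover have "F = fst (below_factor X)"
    unfolding comp[symmetric] H_eq one_arrow_comp_below_arrow[OF F] by (simp add: below_factor_def)
  ultimately show ?thesis
    by (auto simp: H_eq prod_eq_iff fun_eq_iff)
qed

section \<open>Existence of the factorisation\<close>

context
  fixes R :: "('o2, 'a2, 'p2) doctrine_data" and G \<gg>
  assumes G\<gg>: "primary_one_arrow P R (G, \<gg>)"
    and top_le: "\<top>\<^bsub>fib R (fobj G t)\<^esub> \<sqsubseteq>\<^bsub>fib R (fobj G t)\<^esub> \<gg> t \<phi>"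
begin

interpretation R: primary_doctrine R using G\<gg> by simp

interpretation G: fp_functor "base P" "base R" G using G\<gg> by simp

lemma G_closed: "A \<in> Obj (base P) \<Longrightarrow> fobj G A \<in> Obj (base R)"
  using G.fobj_closed by blast

lemma fib_G_semilattice: "A \<in> Obj (base P) \<Longrightarrow> bounded_meet_semilattice (fib R (fobj G A))"
  by (simp add: bounded_meet_semilattice_def R.fib_meets R.fib_top G_closed)

lemma gg_closed:
  "\<lbrakk>A \<in> Obj (base P); \<alpha> \<in> carrier (fib P A)\<rbrakk> \<Longrightarrow> \<gg> A \<alpha> \<in> carrier (fib R (fobj G A))"
  using G\<gg> by auto

text \<open>Naturality at \<open>!_A\<close> transports \<open>\<gg> t \<phi> = \<top>\<close> from
  \<open>t\<close> to \<open>A\<close>, since reindexing in \<open>R\<close> preserves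
  \<open>\<top>\<close>.\<close>

lemma gg_truth:
  assumes A: "A \<in> Obj (base P)"
  shows "\<gg> A (truth A) = \<top>\<^bsub>fib R (fobj G A)\<^esub>"
proof -
  interpret T: bounded_meet_semilattice "fib R (fobj G t)"
    using fib_G_semilattice t_closed .
  have "\<gg> t \<phi> = \<top>\<^bsub>fib R (fobj G t)\<^esub>"
    using gg_closed[OF t_closed truth_value] top_le by (intro T.le_antisym) auto
  moreover have "\<gg> A (truth A) = reindex R (farr G (bang (base P) t A)) (\<gg> t \<phi>)"
    using G\<gg> A t_closed truth_value bang_closed by simp
  ultimately show ?thesis
    using R.reindex_meets[OF G.farr_closed[OF bang_closed[OF A]]]
    by (simp add: preserves_finite_meets_def)
qed

text \<open>\<open>\<gg> A\<close> preserves the meet and turns \<open>truth A\<close> into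
  \<open>\<top>\<close>, which is neutral.\<close>

lemma gg_truth_meet:
  assumes A: "A \<in> Obj (base P)" and \<alpha>: "\<alpha> \<in> carrier (fib P A)"
  shows "\<gg> A (truth A \<sqinter>\<^bsub>fib P A\<^esub> \<alpha>) = \<gg> A \<alpha>"
  using G\<gg> A \<alpha> truth_closed gg_truth
    bounded_meet_semilattice.top_meet[OF fib_G_semilattice[OF A] gg_closed[OF A \<alpha>]]
  by (simp add: preserves_finite_meets_def)

lemma below_factor_comp: "one_arrow_comp P (below_factor (G, \<gg>)) (below_arrow P t \<phi>) = (G, \<gg>)"
proof -
  have ext: "\<gg> \<in> extensional (Obj (base P))"
    "\<And>A. A \<in> Obj (base P) \<Longrightarrow> \<gg> A \<in> extensional (carrier (fib P A))"
    using G\<gg> by (auto simp: PiE_def)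
  \<comment> \<open>Meeting with \<open>truth A\<close> lands in the carrier to which
    \<open>below_factor\<close> restricts \<open>\<gg> A\<close>, so the composite reads genuine
    values of \<open>\<gg>\<close>.\<close>
  have "truth A \<sqinter>\<^bsub>fib P A\<^esub> \<alpha> \<in> carrier (fib Q A)"
    if "A \<in> Obj (base P)" "\<alpha> \<in> carrier (fib P A)" for A \<alpha>
    unfolding fib_Q using meet_in_down[OF fib_semilattice truth_closed] that by blast
  then show ?thesis
    using ext gg_truth_meet
    by (auto simp: below_factor_def one_arrow_comp_below_arrow[OF G.fp_functor_axioms]
        fun_eq_iff restrict_def extensional_def)
qed

text \<open>Naturality, monotonicity and binary meets restrict from \<open>\<gg>\<close>. The top of
  \<open>fib Q A\<close> is \<open>truth A\<close>, which \<open>gg_truth\<close> sends to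
  \<open>\<top>\<close>.\<close>

lemma primary_below_factor: "primary_one_arrow Q R (below_factor (G, \<gg>))"
proof -
  interpret Q: primary_doctrine Q by (rule primary_doctrine_Q)
  have top: "\<top>\<^bsub>fib Q A\<^esub> \<in> carrier (fib Q A)" if "A \<in> Obj (base P)" for A
    using weak_partial_order_top.top_closed[OF Q.fib_top] that by simp
  have meet: "\<alpha> \<sqinter>\<^bsub>fib Q A\<^esub> \<beta> \<in> carrier (fib Q A)"
    if "A \<in> Obj (base P)" "\<alpha> \<in> carrier (fib Q A)" "\<beta> \<in> carrier (fib Q A)" for A \<alpha> \<beta>
  proof -
    interpret bounded_meet_semilattice "fib Q A" using fib_Q_semilattice that(1) .
    show ?thesis using that by simp
  qed
  have "isotone (fib Q A) (fib R (fobj G A)) (restrict (\<gg> A) (carrier (fib Q A)))"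
    if "A \<in> Obj (base P)" for A
    using isotone_restrict_Q[of A "fib R (fobj G A)" "\<gg> A"] G\<gg> that
    by (simp add: isotone_def)
  moreover have "preserves_finite_meets (fib Q A) (fib R (fobj G A))
      (restrict (\<gg> A) (carrier (fib Q A)))" if A: "A \<in> Obj (base P)" for A
    using G\<gg> A top[OF A] meet[OF A] gg_truth[OF A]
    by (simp add: preserves_finite_meets_def top_Q meet_Q carrier_Q_subset)
  ultimately show ?thesis
    using primary_doctrine_Q Q.doctrine_axioms G\<gg> reindex_Q_closed
    by (auto simp: below_factor_def carrier_Q_subset gg_closed)
qed

end

end

section \<open>Identity 2-cells and the conclusion\<close>

lemma invertible_id_two_cell:
  assumes "one_arrow P R X"
  shows "invertible_two_cell P R X X (id_two_cell P R X)"
proof -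
  obtain F \<ff> where X: "X = (F, \<ff>)" by fastforce
  interpret P: doctrine P using assms by (simp add: X)
  interpret R: doctrine R using assms by (simp add: X)
  interpret F: fp_functor "base P" "base R" F using assms by (simp add: X)
  have F: "fobj F A \<in> Obj (base R)" if "A \<in> Obj (base P)" for A
    using F.fobj_closed that by blast
  have ff: "\<ff> A \<alpha> \<in> carrier (fib R (fobj F A))"
    if "A \<in> Obj (base P)" "\<alpha> \<in> carrier (fib P A)" for A \<alpha>
    using assms that by (auto simp: X)
  \<comment> \<open>Reindexing along an identity is trivial, so the inequality demanded of the
    identity 2-cell is reflexivity.\<close>
  have refl: "\<ff> A \<alpha> \<sqsubseteq>\<^bsub>fib R (fobj F A)\<^esub> \<ff> A \<alpha>"
    if "A \<in> Obj (base P)" "\<alpha> \<in> carrier (fib P A)" for A \<alpha>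
    using weak_partial_order.le_refl[OF partial_order.axioms(1)[OF R.fib_poset[OF F]]] ff that
    by blast
  have "two_cell P R X X (id_two_cell P R X)"
    using F ff refl
    by (simp add: X R.base.id_closed R.reindex_id R.base.id_left[OF F.farr_closed]
        R.base.id_right[OF F.farr_closed])
  moreover have "two_cell_comp P R (id_two_cell P R X) (id_two_cell P R X) = id_two_cell P R X"
    using F by (auto simp: X two_cell_comp_def R.base.id_left[OF R.base.id_closed]
        intro!: restrict_ext)
  ultimately show ?thesis
    by (auto simp: invertible_two_cell_def)
qed

theorem corollary6p5:
  fixes P :: "('o, 'a, 'p) doctrine_data" and t :: 'o and \<phi> :: 'p
  assumes "primary_doctrine P"
    and "terminal (base P) t"
    and "\<phi> \<in> carrier (fib P t)"
  shows "primary_one_arrow P (below_doctrine P t \<phi>) (below_arrow P t \<phi>) \<and>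
    \<top>\<^bsub>fib (below_doctrine P t \<phi>) t\<^esub> \<sqsubseteq>\<^bsub>fib (below_doctrine P t \<phi>) t\<^esub> below_map P t \<phi> t \<phi> \<and>
    (\<forall>(R :: ('o2, 'a2, 'p2) doctrine_data) G \<gg>.
       primary_doctrine R \<and> primary_one_arrow P R (G, \<gg>) \<and>
       \<top>\<^bsub>fib R (fobj G t)\<^esub> \<sqsubseteq>\<^bsub>fib R (fobj G t)\<^esub> \<gg> t \<phi> \<longrightarrow>
       (\<exists>H. primary_one_arrow (below_doctrine P t \<phi>) R H \<and>
            one_arrow_comp P H (below_arrow P t \<phi>) = (G, \<gg>)) \<and>
       (\<forall>H K. primary_one_arrow (below_doctrine P t \<phi>) R H \<and>
              one_arrow_comp P H (below_arrow P t \<phi>) = (G, \<gg>) \<and>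
              primary_one_arrow (below_doctrine P t \<phi>) R K \<and>
              one_arrow_comp P K (below_arrow P t \<phi>) = (G, \<gg>) \<longrightarrow>
              (\<exists>!\<theta>. invertible_two_cell (below_doctrine P t \<phi>) R H K \<theta> \<and>
                    whisker P \<theta> (below_arrow P t \<phi>) = id_two_cell P R (G, \<gg>))))"
proof -
  interpret pointed_primary_doctrine P t \<phi>
    using assms by (simp add: pointed_primary_doctrine_def pointed_primary_doctrine_axioms_def)
  have uniq: "\<exists>!\<theta>. invertible_two_cell Q R H K \<theta> \<and>
      whisker P \<theta> (below_arrow P t \<phi>) = id_two_cell P R (G, \<gg>)"
    if H: "primary_one_arrow Q R H" "one_arrow_comp P H (below_arrow P t \<phi>) = (G, \<gg>)"
      and K: "primary_one_arrow Q R K" "one_arrow_comp P K (below_arrow P t \<phi>) = (G, \<gg>)"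
    for R :: "('o2, 'a2, 'p2) doctrine_data" and G \<gg> H K
  proof -
    have one: "one_arrow Q R H" "one_arrow Q R K"
      using H(1) K(1) by (cases H; cases K; simp)+
    \<comment> \<open>Both factorisations are the same explicit pair, so the wanted 2-cell goes from
      \<open>H\<close> to itself.\<close>
    have "H = below_factor (G, \<gg>)" "K = below_factor (G, \<gg>)"
      using below_factor_unique[OF one(1) H(2)] below_factor_unique[OF one(2) K(2)] by auto
    \<comment> \<open>\<open>below_factor\<close> keeps the functor and \<open>Q\<close> keeps the
      base, so the two identity 2-cells coincide.\<close>
    then have "K = H" and id: "id_two_cell P R (G, \<gg>) = id_two_cell Q R H"
      by (auto simp: below_factor_def)
    \<comment> \<open>The 1-arrow is the identity on objects, so whiskering returns an extensional
      \<open>\<theta>\<close> unchanged; the whiskering condition then forces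
      \<open>\<theta>\<close> to be the identity 2-cell.\<close>
    have whisker: "whisker P \<theta> (below_arrow P t \<phi>) = \<theta>"
      if "\<theta> \<in> extensional (Obj (base P))" for \<theta> :: "'o \<Rightarrow> 'a2"
      using that by (auto simp: below_arrow_def id_functor_def compose_def restrict_def
          extensional_def fun_eq_iff)
    have ext: "\<theta> \<in> extensional (Obj (base P))" if "invertible_two_cell Q R H H \<theta>" for \<theta>
      using that by (cases H) (simp add: invertible_two_cell_def)
    show ?thesis
      unfolding \<open>K = H\<close> id
      using invertible_id_two_cell[OF one(1)] whisker ext by metis
  qed
  show ?thesis
    using primary_below_arrow top_le_below_map primary_below_factor below_factor_comp uniq by blast
qed

end
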